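(* Let $\alpha$ be a formula of (propositional) constructive logic with strong negation (CLSN). Then the following conditions are equivalent: (a) $\alpha$ is a theorem of CLSN; (b) $\alpha$ is valid in every finite rough set-based Nelson algebra determined by a quasiorder, that is, in every finite Nelson algebra of the form $\mathbb{IRS}_R(U)$, where $R$ is a quasiorder on a set $U$.
   Context: CLSN (Nelson logic): formulas are built from propositional variables with connectives $\vee,\wedge,\rightarrow$, weak negation $\neg$ and strong negation $\sim$. A standard Hilbert-style axiomatisation has modus ponens as its only rule, and as axiom schemata: those of positive intuitionistic propositional logic for $\vee,\wedge,\rightarrow$; $(\alpha\to\neg\beta)\to(\beta\to\neg\alpha)$; $\neg(\alpha\to\alpha)\to\beta$; ${\sim}\alpha\to(\alpha\to\beta)$; ${\sim}(\alpha\to\beta)\leftrightarrow(\alpha\wedge{\sim}\beta)$; ${\sim}(\alpha\wedge\beta)\leftrightarrow({\sim}\alpha\vee{\sim}\beta)$; ${\sim}(\alpha\vee\beta)\leftrightarrow({\sim}\alpha\wedge{\sim}\beta)$; ${\sim}\neg\alpha\leftrightarrow\alpha$; ${\sim}{\sim}\alpha\leftrightarrow\alpha$, where $\alpha\leftrightarrow\beta$ abbreviates $(\alpha\to\beta)\wedge(\beta\to\alpha)$. A Kleene algebra $(A,\vee,\wedge,{\sim},0,1)$ is a bounded distributive lattice with a unary operation $\sim$ such that for all $a,b$: ${\sim}{\sim}a=a$; $a\le b$ iff ${\sim}b\le{\sim}a$; $a\wedge{\sim}a\le b\vee{\sim}b$. A Nelson algebra $(A,\vee,\wedge,\to,{\sim},0,1)$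 is a Kleene algebra with a binary operation $\to$ such that for all $a,b,c$: $a\wedge c\le{\sim}a\vee b$ iff $c\le a\to b$; and $(a\wedge b)\to c=a\to(b\to c)$. In a Nelson algebra, $\neg a:=a\to 0$. A formula is valid in a Nelson algebra if its value is $1$ under every valuation of the propositional variables in the algebra, the connectives being interpreted by the corresponding operations. A quasiorder on $U$ is a reflexive and transitive binary relation $R$ on $U$. Put $R(x)=\{y\in U\mid x\,R\,y\}$, and for $X\subseteq U$ let $X_R=\{x\in U\mid R(x)\subseteq X\}$, $X^R=\{x\in U\mid R(x)\cap X\neq\emptyset\}$, and $-X=U\setminus X$. Let $\mathit{IRS}_R(U)=\{(X_R,X^R)\mid X\subseteq U\}$. The rough set-based Nelson algebra $\mathbb{IRS}_R(U)$ determined by $R$ is the Nelson algebra on $\mathit{IRS}_R(U)$ (ordered by coordinatewise inclusion, with $0=(\emptyset,\emptyset)$ and $1=(U,U)$) with operations $(X_R,X^R)\vee(Y_R,Y^R)=(X_R\cup Y_R,X^R\cup Y^R)$, $(X_R,X^R)\wedge(Y_R,Y^R)=(X_R\cap Y_R,X^R\cap Y^R)$, ${\sim}(X_R,X^R)=(-X^R,-X_R)$, $(X_R,X^R)\to(Y_R,Y^R)=((-X_R\cup Y_R)_R,\,-X_R\cup Y^R)$. *)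

theory Defs
  imports Main
begin

section \<open>Constructive logic with strong negation\<close>

datatype 'v form =
    Var 'v
  | Disj "'v form" "'v form"  (infixr "\<^bold>\<or>" 110)
  | Conj "'v form" "'v form"  (infixr "\<^bold>\<and>" 115)
  | Impl "'v form" "'v form"  (infixr "\<^bold>\<rightarrow>" 105)
  | WNeg "'v form"  ("\<^bold>\<not> _" [120] 120)
  | SNeg "'v form"  ("\<^bold>\<sim> _" [120] 120)

abbreviation Iff :: "'v form \<Rightarrow> 'v form \<Rightarrow> 'v form"  (infix "\<^bold>\<leftrightarrow>" 100) where
  "\<alpha> \<^bold>\<leftrightarrow> \<beta> \<equiv> (\<alpha> \<^bold>\<rightarrow> \<beta>) \<^bold>\<and> (\<beta> \<^bold>\<rightarrow> \<alpha>)"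

inductive CLSN_theorem :: "'v form \<Rightarrow> bool" where
  MP: "CLSN_theorem \<alpha> \<Longrightarrow> CLSN_theorem (\<alpha> \<^bold>\<rightarrow> \<beta>) \<Longrightarrow> CLSN_theorem \<beta>"
| Impl_K: "CLSN_theorem (\<alpha> \<^bold>\<rightarrow> (\<beta> \<^bold>\<rightarrow> \<alpha>))"
| Impl_S: "CLSN_theorem ((\<alpha> \<^bold>\<rightarrow> (\<beta> \<^bold>\<rightarrow> \<gamma>)) \<^bold>\<rightarrow> ((\<alpha> \<^bold>\<rightarrow> \<beta>) \<^bold>\<rightarrow> (\<alpha> \<^bold>\<rightarrow> \<gamma>)))"
| Conj_E1: "CLSN_theorem ((\<alpha> \<^bold>\<and> \<beta>) \<^bold>\<rightarrow> \<alpha>)"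
| Conj_E2: "CLSN_theorem ((\<alpha> \<^bold>\<and> \<beta>) \<^bold>\<rightarrow> \<beta>)"
| Conj_I: "CLSN_theorem (\<alpha> \<^bold>\<rightarrow> (\<beta> \<^bold>\<rightarrow> (\<alpha> \<^bold>\<and> \<beta>)))"
| Disj_I1: "CLSN_theorem (\<alpha> \<^bold>\<rightarrow> (\<alpha> \<^bold>\<or> \<beta>))"
| Disj_I2: "CLSN_theorem (\<beta> \<^bold>\<rightarrow> (\<alpha> \<^bold>\<or> \<beta>))"
| Disj_E: "CLSN_theorem ((\<alpha> \<^bold>\<rightarrow> \<gamma>) \<^bold>\<rightarrow> ((\<beta> \<^bold>\<rightarrow> \<gamma>) \<^bold>\<rightarrow> ((\<alpha> \<^bold>\<or> \<beta>) \<^bold>\<rightarrow> \<gamma>)))"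
| WNeg_contrapos: "CLSN_theorem ((\<alpha> \<^bold>\<rightarrow> \<^bold>\<not> \<beta>) \<^bold>\<rightarrow> (\<beta> \<^bold>\<rightarrow> \<^bold>\<not> \<alpha>))"
| WNeg_explosion: "CLSN_theorem (\<^bold>\<not> (\<alpha> \<^bold>\<rightarrow> \<alpha>) \<^bold>\<rightarrow> \<beta>)"
| SNeg_explosion: "CLSN_theorem (\<^bold>\<sim> \<alpha> \<^bold>\<rightarrow> (\<alpha> \<^bold>\<rightarrow> \<beta>))"
| SNeg_Impl: "CLSN_theorem (\<^bold>\<sim> (\<alpha> \<^bold>\<rightarrow> \<beta>) \<^bold>\<leftrightarrow> (\<alpha> \<^bold>\<and> \<^bold>\<sim> \<beta>))"
| SNeg_Conj: "CLSN_theorem (\<^bold>\<sim> (\<alpha> \<^bold>\<and> \<beta>) \<^bold>\<leftrightarrow> (\<^bold>\<sim> \<alpha> \<^bold>\<or> \<^bold>\<sim> \<beta>))"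
| SNeg_Disj: "CLSN_theorem (\<^bold>\<sim> (\<alpha> \<^bold>\<or> \<beta>) \<^bold>\<leftrightarrow> (\<^bold>\<sim> \<alpha> \<^bold>\<and> \<^bold>\<sim> \<beta>))"
| SNeg_WNeg: "CLSN_theorem (\<^bold>\<sim> (\<^bold>\<not> \<alpha>) \<^bold>\<leftrightarrow> \<alpha>)"
| SNeg_SNeg: "CLSN_theorem (\<^bold>\<sim> (\<^bold>\<sim> \<alpha>) \<^bold>\<leftrightarrow> \<alpha>)"

section \<open>Nelson algebras\<close>

record 'a nelson =
  carrier :: "'a set"
  join :: "'a \<Rightarrow> 'a \<Rightarrow> 'a"  (infixl "\<squnion>\<index>" 65)
  meet :: "'a \<Rightarrow> 'a \<Rightarrow> 'a"  (infixl "\<sqinter>\<index>" 70)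
  imp :: "'a \<Rightarrow> 'a \<Rightarrow> 'a"  (infixr "\<leadsto>\<index>" 60)
  sneg :: "'a \<Rightarrow> 'a"  ("\<sim>\<index> _" [81] 80)
  zero :: 'a  ("\<zero>\<index>")
  one :: 'a  ("\<one>\<index>")

definition le :: "('a, 'b) nelson_scheme \<Rightarrow> 'a \<Rightarrow> 'a \<Rightarrow> bool"  (infix "\<preceq>\<index>" 50) where
  "a \<preceq>\<^bsub>A\<^esub> b \<longleftrightarrow> a \<sqinter>\<^bsub>A\<^esub> b = a"

definition wneg :: "('a, 'b) nelson_scheme \<Rightarrow> 'a \<Rightarrow> 'a" where
  "wneg A a = a \<leadsto>\<^bsub>A\<^esub> \<zero>\<^bsub>A\<^esub>"

locale kleene_algebra =
  fixes A :: "('a, 'b) nelson_scheme" (structure)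
  assumes join_closed: "\<lbrakk>a \<in> carrier A; b \<in> carrier A\<rbrakk> \<Longrightarrow> a \<squnion> b \<in> carrier A"
    and meet_closed: "\<lbrakk>a \<in> carrier A; b \<in> carrier A\<rbrakk> \<Longrightarrow> a \<sqinter> b \<in> carrier A"
    and sneg_closed: "a \<in> carrier A \<Longrightarrow> \<sim> a \<in> carrier A"
    and zero_closed: "\<zero> \<in> carrier A"
    and one_closed: "\<one> \<in> carrier A"
    and join_comm: "\<lbrakk>a \<in> carrier A; b \<in> carrier A\<rbrakk> \<Longrightarrow> a \<squnion> b = b \<squnion> a"
    and meet_comm: "\<lbrakk>a \<in> carrier A; b \<in> carrier A\<rbrakk> \<Longrightarrow> a \<sqinter> b = b \<sqinter> a"
    and join_assoc: "\<lbrakk>a \<in> carrier A; b \<in> carrier A; c \<in> carrier A\<rbrakk> \<Longrightarrow> (a \<squnion> b) \<squnion> c = a \<squnion> (b \<squnion> c)"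
    and meet_assoc: "\<lbrakk>a \<in> carrier A; b \<in> carrier A; c \<in> carrier A\<rbrakk> \<Longrightarrow> (a \<sqinter> b) \<sqinter> c = a \<sqinter> (b \<sqinter> c)"
    and join_absorb: "\<lbrakk>a \<in> carrier A; b \<in> carrier A\<rbrakk> \<Longrightarrow> a \<squnion> (a \<sqinter> b) = a"
    and meet_absorb: "\<lbrakk>a \<in> carrier A; b \<in> carrier A\<rbrakk> \<Longrightarrow> a \<sqinter> (a \<squnion> b) = a"
    and distrib: "\<lbrakk>a \<in> carrier A; b \<in> carrier A; c \<in> carrier A\<rbrakk> \<Longrightarrow> a \<sqinter> (b \<squnion> c) = (a \<sqinter> b) \<squnion> (a \<sqinter> c)"
    and zero_least: "a \<in> carrier A \<Longrightarrow> \<zero> \<preceq> a"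
    and one_greatest: "a \<in> carrier A \<Longrightarrow> a \<preceq> \<one>"
    and sneg_sneg: "a \<in> carrier A \<Longrightarrow> \<sim> (\<sim> a) = a"
    and sneg_antimono: "\<lbrakk>a \<in> carrier A; b \<in> carrier A\<rbrakk> \<Longrightarrow> a \<preceq> b \<longleftrightarrow> \<sim> b \<preceq> \<sim> a"
    and kleene: "\<lbrakk>a \<in> carrier A; b \<in> carrier A\<rbrakk> \<Longrightarrow> a \<sqinter> \<sim> a \<preceq> b \<squnion> \<sim> b"

locale nelson_algebra = kleene_algebra +
  assumes imp_closed: "\<lbrakk>a \<in> carrier A; b \<in> carrier A\<rbrakk> \<Longrightarrow> a \<leadsto> b \<in> carrier A"
    and residual: "\<lbrakk>a \<in> carrier A; b \<in> carrier A; c \<in> carrier A\<rbrakk> \<Longrightarrow>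
          a \<sqinter> c \<preceq> \<sim> a \<squnion> b \<longleftrightarrow> c \<preceq> a \<leadsto> b"
    and curry: "\<lbrakk>a \<in> carrier A; b \<in> carrier A; c \<in> carrier A\<rbrakk> \<Longrightarrow>
          (a \<sqinter> b) \<leadsto> c = a \<leadsto> (b \<leadsto> c)"

primrec eval :: "('a, 'b) nelson_scheme \<Rightarrow> ('v \<Rightarrow> 'a) \<Rightarrow> 'v form \<Rightarrow> 'a" where
  "eval A v (Var p) = v p"
| "eval A v (\<alpha> \<^bold>\<or> \<beta>) = eval A v \<alpha> \<squnion>\<^bsub>A\<^esub> eval A v \<beta>"
| "eval A v (\<alpha> \<^bold>\<and> \<beta>) = eval A v \<alpha> \<sqinter>\<^bsub>A\<^esub> eval A v \<beta>"
| "eval A v (\<alpha> \<^bold>\<rightarrow> \<beta>) = eval A v \<alpha> \<leadsto>\<^bsub>A\<^esub> eval A v \<beta>"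
| "eval A v (\<^bold>\<not> \<alpha>) = wneg A (eval A v \<alpha>)"
| "eval A v (\<^bold>\<sim> \<alpha>) = \<sim>\<^bsub>A\<^esub> (eval A v \<alpha>)"

definition valid_in :: "('a, 'b) nelson_scheme \<Rightarrow> 'v form \<Rightarrow> bool" where
  "valid_in A \<alpha> \<longleftrightarrow> (\<forall>v. (\<forall>p. v p \<in> carrier A) \<longrightarrow> eval A v \<alpha> = \<one>\<^bsub>A\<^esub>)"

section \<open>Rough sets determined by a quasiorder\<close>

text \<open>A quasiorder on \<open>U\<close> is \<open>preorder_on U R\<close>: \<open>R \<subseteq> U \<times> U\<close>, reflexive on \<open>U\<close> and transitive.\<close>

definition lower :: "'u set \<Rightarrow> ('u \<times> 'u) set \<Rightarrow> 'u set \<Rightarrow> 'u set" where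
  "lower U R X = {x \<in> U. R `` {x} \<subseteq> X}"

definition upper :: "'u set \<Rightarrow> ('u \<times> 'u) set \<Rightarrow> 'u set \<Rightarrow> 'u set" where
  "upper U R X = {x \<in> U. R `` {x} \<inter> X \<noteq> {}}"

definition IRS :: "'u set \<Rightarrow> ('u \<times> 'u) set \<Rightarrow> ('u set \<times> 'u set) nelson" where
  "IRS U R =
    \<lparr> carrier = {(lower U R X, upper U R X) | X. X \<subseteq> U},
      join = (\<lambda>(A, B) (C, D). (A \<union> C, B \<union> D)),
      meet = (\<lambda>(A, B) (C, D). (A \<inter> C, B \<inter> D)),
      imp = (\<lambda>(A, B) (C, D). (lower U R ((U - A) \<union> C), (U - A) \<union> D)),
      sneg = (\<lambda>(A, B). (U - B, U - A)),
      zero = ({}, {}),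
      one = (U, U) \<rparr>"

text \<open>
  For a quasiorder \<open>R\<close> on an arbitrary set \<open>U\<close>, \<open>IRS U R\<close> is a Nelson algebra. The closure of
  its carrier under the operations rests on the description of the carrier in \<open>carrier_IRS_iff\<close>.
\<close>

lemma split_between:
  assumes R: "preorder_on U R" and sub: "A \<subseteq> B" "B \<subseteq> U"
    and up: "R `` A \<subseteq> A" and down: "R\<inverse> `` B \<subseteq> B"
    and sing: "\<And>x. x \<in> B \<Longrightarrow> R `` {x} = {x} \<Longrightarrow> x \<in> A"
  shows "\<exists>X\<subseteq>U. lower U R X = A \<and> upper U R X = B"
proof -
  have refl: "\<And>x. x \<in> U \<Longrightarrow> (x, x) \<in> R" and trans: "trans R" and RU: "R \<subseteq> U \<times> U"
    using R by (auto simp: preorder_on_def refl_on_def)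
  let ?base = "A \<times> {True} \<union> (U - B) \<times> {False}"
  define good where "good S \<longleftrightarrow> ?base \<subseteq> S \<and> S \<subseteq> U \<times> UNIV \<and> (\<forall>x. \<not> ((x, True) \<in> S \<and> (x, False) \<in> S))
     \<and> (\<forall>x c. (x, c) \<in> S \<longrightarrow> (x, c) \<in> ?base \<or> (\<exists>y. (x, y) \<in> R \<and> (y, \<not> c) \<in> S))" for S
  have base: "good ?base" unfolding good_def using sub by auto
  have goodD: "?base \<subseteq> S" "S \<subseteq> U \<times> UNIV" "\<And>x. (x, True) \<in> S \<Longrightarrow> (x, False) \<in> S \<Longrightarrow> False"
      "\<And>x c. (x, c) \<in> S \<Longrightarrow> (x, c) \<in> ?base \<or> (\<exists>y. (x, y) \<in> R \<and> (y, \<not> c) \<in> S)"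
    if "good S" for S
    using that unfolding good_def by simp_all
  have "\<exists>M\<in>Collect good. \<forall>S\<in>Collect good. M \<subseteq> S \<longrightarrow> S = M"
  proof (rule subset_Zorn_nonempty)
    show "Collect good \<noteq> {}" using base by blast
    fix \<C> assume ne: "\<C> \<noteq> {}" and ch: "subset.chain (Collect good) \<C>"
    have g: "\<And>S. S \<in> \<C> \<Longrightarrow> good S" and lin: "\<And>S T. S \<in> \<C> \<Longrightarrow> T \<in> \<C> \<Longrightarrow> S \<subseteq> T \<or> T \<subseteq> S"
      using ch by (auto simp: subset_chain_def)
    have "\<not> ((x, True) \<in> \<Union>\<C> \<and> (x, False) \<in> \<Union>\<C>)" for x
    proof
      assume "(x, True) \<in> \<Union>\<C> \<and> (x, False) \<in> \<Union>\<C>"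
      then obtain S T where "S \<in> \<C>" "T \<in> \<C>" "(x, True) \<in> S" "(x, False) \<in> T" by blast
      then show False using lin[of S T] goodD(3)[of S x] goodD(3)[of T x] g by auto
    qed
    moreover have "?base \<subseteq> \<Union>\<C>" using ne g goodD(1) by (metis Union_upper all_not_in_conv subset_trans)
    moreover have "\<Union>\<C> \<subseteq> U \<times> UNIV" using g goodD(2) by (metis Sup_least)
    moreover have "(x, c) \<in> ?base \<or> (\<exists>y. (x, y) \<in> R \<and> (y, \<not> c) \<in> \<Union>\<C>)" if m: "(x, c) \<in> \<Union>\<C>" for x c
    proof -
      obtain S where "S \<in> \<C>" "(x, c) \<in> S" using m by blast
      then show ?thesis using goodD(4)[OF g, of S x c] by blast
    qed
    ultimately show "\<Union>\<C> \<in> Collect good" unfolding good_def mem_Collect_eq by (intro conjI allI impI) auto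
  qed
  then obtain M where M: "good M" and maxi: "\<And>S. good S \<Longrightarrow> M \<subseteq> S \<Longrightarrow> S = M" by blast
  have Mbase: "?base \<subseteq> M" and MU: "M \<subseteq> U \<times> UNIV"
    and Mdisj: "\<And>x. (x, True) \<in> M \<Longrightarrow> (x, False) \<in> M \<Longrightarrow> False"
    and Mabove: "\<And>x c. (x, c) \<in> M \<Longrightarrow> (x, c) \<in> ?base \<or> (\<exists>y. (x, y) \<in> R \<and> (y, \<not> c) \<in> M)"
    using goodD[OF M] by simp_all
  have extend: "N \<subseteq> M" if NU: "N \<subseteq> U \<times> UNIV"
      and Nd: "\<And>x. (x, True) \<in> M \<union> N \<Longrightarrow> (x, False) \<in> M \<union> N \<Longrightarrow> False"
      and Na: "\<And>x c. (x, c) \<in> N \<Longrightarrow> \<exists>y. (x, y) \<in> R \<and> (y, \<not> c) \<in> M \<union> N" for N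
  proof -
    have "good (M \<union> N)" unfolding good_def
    proof (intro conjI allI impI)
      show "?base \<subseteq> M \<union> N" using Mbase by blast
      show "M \<union> N \<subseteq> U \<times> UNIV" using MU NU by blast
      show "\<not> ((x, True) \<in> M \<union> N \<and> (x, False) \<in> M \<union> N)" for x using Nd by blast
      show "(x, c) \<in> ?base \<or> (\<exists>y. (x, y) \<in> R \<and> (y, \<not> c) \<in> M \<union> N)" if m: "(x, c) \<in> M \<union> N" for x c
        using m Mabove[of x c] Na[of x c] by blast
    qed
    then show ?thesis using maxi by blast
  qed
  have total: "(x, True) \<in> M \<or> (x, False) \<in> M" if xU: "x \<in> U" for x
  proof (rule ccontr)
    assume un: "\<not> ((x, True) \<in> M \<or> (x, False) \<in> M)"
    have free: "(y, c) \<notin> M" if xy: "(x, y) \<in> R" for y c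
    proof
      assume yc: "(y, c) \<in> M"
      have "{(x, \<not> c)} \<subseteq> M"
      proof (rule extend)
        show "{(x, \<not> c)} \<subseteq> U \<times> UNIV" using xU by simp
        show False if "(z, True) \<in> M \<union> {(x, \<not> c)}" "(z, False) \<in> M \<union> {(x, \<not> c)}" for z
          using that un Mdisj[of z] by auto
        show "\<exists>y. (z, y) \<in> R \<and> (y, \<not> d) \<in> M \<union> {(x, \<not> c)}" if "(z, d) \<in> {(x, \<not> c)}" for z d
          using that xy yc by auto
      qed
      then show False using un by (cases c) auto
    qed
    have between: "y \<in> B - A" if xy: "(x, y) \<in> R" for y
      using free[OF xy] Mbase xy RU by blast
    have "\<exists>g. \<forall>n. (x, g n) \<in> R \<and> ((g n, g (Suc n)) \<in> R \<and> g (Suc n) \<noteq> g n)"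
    proof -
      have "\<exists>z. (x, z) \<in> R \<and> (y, z) \<in> R \<and> z \<noteq> y" if xy: "(x, y) \<in> R" for y
      proof -
        have "R `` {y} \<noteq> {y}" using sing[of y] between[OF xy] by blast
        then obtain z where "(y, z) \<in> R" "z \<noteq> y" using refl[of y] xy RU by blast
        then show ?thesis using trans xy by (meson transD)
      qed
      then show ?thesis
        using refl[OF xU] by (intro dependent_nat_choice) blast+
    qed
    then obtain g where xg: "\<And>n. (x, g n) \<in> R" and step: "\<And>n. (g n, g (Suc n)) \<in> R"
      and neq: "\<And>n. g (Suc n) \<noteq> g n" by blast
    have gU: "\<And>n. g n \<in> U" using xg RU by blast
    have mono: "m \<le> n \<Longrightarrow> (g m, g n) \<in> R" for m n
    proof (induction n rule: nat_induct)
      case 0 then show ?case using refl gU by simp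
    next
      case (Suc n)
      then show ?case using refl[OF gU] step[of n] trans by (cases "m = Suc n") (auto dest: transD)
    qed
    show False
    proof (cases "inj g")
      case True
      let ?N = "range (\<lambda>n. (g n, even n))"
      have "?N \<subseteq> M"
      proof (rule extend)
        show "?N \<subseteq> U \<times> UNIV" using gU by blast
        show False if "(y, True) \<in> M \<union> ?N" "(y, False) \<in> M \<union> ?N" for y
          using that free xg Mdisj[of y] by (auto dest!: injD[OF True])
        show "\<exists>z. (y, z) \<in> R \<and> (z, \<not> c) \<in> M \<union> ?N" if yc: "(y, c) \<in> ?N" for y c
        proof -
          obtain n where n: "y = g n" "c = even n" using yc by blast
          have "(g (Suc n), \<not> c) \<in> ?N" unfolding n by (rule image_eqI[of _ _ "Suc n"]) auto
          then show ?thesis using step[of n] n by blast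
        qed
      qed
      then show False using free[OF xg[of 0]] by blast
    next
      case False
      then obtain m n where "g m = g n" "m < n" by (metis injI linorder_neqE_nat)
      then have "(g (Suc m), g m) \<in> R" using mono[of "Suc m" n] by simp
      let ?N = "{(g m, True), (g (Suc m), False)}"
      have "?N \<subseteq> M"
      proof (rule extend)
        show "?N \<subseteq> U \<times> UNIV" using gU by simp
        show False if "(y, True) \<in> M \<union> ?N" "(y, False) \<in> M \<union> ?N" for y
          using that free[OF xg] neq[of m] Mdisj[of y] by auto
        show "\<exists>z. (y, z) \<in> R \<and> (z, \<not> c) \<in> M \<union> ?N" if "(y, c) \<in> ?N" for y c
          using that step[of m] \<open>(g (Suc m), g m) \<in> R\<close> by auto
      qed
      then show False using free[OF xg[of m]] by blast
    qed
  qed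
  define X where "X = {x. (x, True) \<in> M}"
  have XU: "X \<subseteq> U" using MU X_def by blast
  have AX: "A \<subseteq> X" and XB: "X \<subseteq> B" using Mbase MU Mdisj unfolding X_def by blast+
  have notX: "x \<notin> X \<Longrightarrow> x \<in> U \<Longrightarrow> (x, False) \<in> M" for x using total X_def by blast
  have "lower U R X = A"
  proof (intro equalityI subsetI)
    fix x assume x: "x \<in> lower U R X"
    then have xX: "x \<in> X" "R `` {x} \<subseteq> X" using refl by (auto simp: lower_def)
    show "x \<in> A" using Mabove[of x True] xX Mdisj unfolding X_def by auto
  next
    fix x assume "x \<in> A"
    then show "x \<in> lower U R X" using up AX sub unfolding lower_def by blast
  qed
  moreover have "upper U R X = B"
  proof (intro equalityI subsetI)
    fix x assume "x \<in> upper U R X"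
    then show "x \<in> B" using XB down unfolding upper_def by blast
  next
    fix x assume x: "x \<in> B"
    show "x \<in> upper U R X"
    proof (cases "x \<in> X")
      case True then show ?thesis using refl x sub unfolding upper_def by blast
    next
      case False
      then have "\<exists>y. (x, y) \<in> R \<and> (y, True) \<in> M" using Mabove[of x False] notX x sub by auto
      then show ?thesis using x sub unfolding upper_def X_def by blast
    qed
  qed
  ultimately show ?thesis using XU by blast
qed

lemma carrier_IRS_iff:
  assumes R: "preorder_on U R"
  shows "(A, B) \<in> carrier (IRS U R) \<longleftrightarrow>
    A \<subseteq> B \<and> B \<subseteq> U \<and> R `` A \<subseteq> A \<and> R\<inverse> `` B \<subseteq> B \<and> (\<forall>x\<in>B. R `` {x} = {x} \<longrightarrow> x \<in> A)"
    (is "?L \<longleftrightarrow> ?P")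
proof
  have refl: "\<And>x. x \<in> U \<Longrightarrow> (x, x) \<in> R" and trans: "\<And>x y z. (x, y) \<in> R \<Longrightarrow> (y, z) \<in> R \<Longrightarrow> (x, z) \<in> R"
    and RU: "R \<subseteq> U \<times> U"
    using R by (auto simp: preorder_on_def refl_on_def dest: transD)
  assume ?L
  then obtain X where X: "X \<subseteq> U" "A = lower U R X" "B = upper U R X" by (auto simp: IRS_def)
  show ?P
  proof (intro conjI)
    show "A \<subseteq> B" "B \<subseteq> U" using refl unfolding X lower_def upper_def by blast+
    show "R `` A \<subseteq> A" using trans RU unfolding X lower_def by blast
    show "R\<inverse> `` B \<subseteq> B" using trans RU unfolding X upper_def by blast
    show "\<forall>x\<in>B. R `` {x} = {x} \<longrightarrow> x \<in> A" unfolding X lower_def upper_def by force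
  qed
next
  assume ?P
  then have "\<exists>X\<subseteq>U. lower U R X = A \<and> upper U R X = B" by (intro split_between[OF R]) auto
  then show ?L by (auto simp: IRS_def)
qed

lemma nelson_algebra_IRS:
  assumes R: "preorder_on U R"
  shows "nelson_algebra (IRS U R)"
proof -
  have refl: "\<And>x. x \<in> U \<Longrightarrow> (x, x) \<in> R" and trans: "\<And>x y z. (x, y) \<in> R \<Longrightarrow> (y, z) \<in> R \<Longrightarrow> (x, z) \<in> R"
    and RU: "R \<subseteq> U \<times> U"
    using R by (auto simp: preorder_on_def refl_on_def dest: transD)
  note [simp] = carrier_IRS_iff[OF R]
  have [simp]: "(A, B) \<squnion>\<^bsub>IRS U R\<^esub> (C, D) = (A \<union> C, B \<union> D)"
    "(A, B) \<sqinter>\<^bsub>IRS U R\<^esub> (C, D) = (A \<inter> C, B \<inter> D)"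
    "(A, B) \<leadsto>\<^bsub>IRS U R\<^esub> (C, D) = (lower U R ((U - A) \<union> C), (U - A) \<union> D)"
    "\<sim>\<^bsub>IRS U R\<^esub> (A, B) = (U - B, U - A)"
    "\<zero>\<^bsub>IRS U R\<^esub> = ({}, {})" "\<one>\<^bsub>IRS U R\<^esub> = (U, U)"
    "(A, B) \<preceq>\<^bsub>IRS U R\<^esub> (C, D) \<longleftrightarrow> A \<subseteq> C \<and> B \<subseteq> D" for A B C D
    by (auto simp: IRS_def le_def)
  show ?thesis
  proof (unfold_locales, goal_cases)
    case (1 a b) then show ?case by (cases a; cases b) auto
  next
    case (2 a b) then show ?case by (cases a; cases b) auto
  next
    case (3 a) then show ?case using RU by (cases a) (simp, blast)
  next
    case 4 then show ?case by simp
  next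
    case 5 then show ?case using RU by auto
  next
    case (6 a b) then show ?case by (cases a; cases b) auto
  next
    case (7 a b) then show ?case by (cases a; cases b) auto
  next
    case (8 a b c) then show ?case by (cases a; cases b; cases c) auto
  next
    case (9 a b c) then show ?case by (cases a; cases b; cases c) auto
  next
    case (10 a b) then show ?case by (cases a; cases b) auto
  next
    case (11 a b) then show ?case by (cases a; cases b) auto
  next
    case (12 a b c) then show ?case by (cases a; cases b; cases c) auto
  next
    case (13 a) then show ?case by (cases a) auto
  next
    case (14 a) then show ?case by (cases a) auto
  next
    case (15 a) then show ?case by (cases a) auto
  next
    case (16 a b) then show ?case by (cases a; cases b) (simp, blast)
  next
    case (17 a b) then show ?case by (cases a; cases b) auto
  next
    case (18 a b)
    obtain A B C D where ab: "a = (A, B)" "b = (C, D)" by fastforce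
    have h: "A \<subseteq> B" "B \<subseteq> U" "R `` A \<subseteq> A" "C \<subseteq> D" "D \<subseteq> U" "R\<inverse> `` D \<subseteq> D"
      "\<forall>x\<in>D. R `` {x} = {x} \<longrightarrow> x \<in> C" using 18 ab by auto
    have "lower U R ((U - A) \<union> C) \<subseteq> (U - A) \<union> D" using refl h unfolding lower_def by blast
    moreover have "(U - A) \<union> D \<subseteq> U" using h by blast
    moreover have "R `` lower U R ((U - A) \<union> C) \<subseteq> lower U R ((U - A) \<union> C)"
      using trans RU unfolding lower_def by blast
    moreover have "R\<inverse> `` ((U - A) \<union> D) \<subseteq> (U - A) \<union> D" using h RU by blast
    moreover have "\<forall>x\<in>(U - A) \<union> D. R `` {x} = {x} \<longrightarrow> x \<in> lower U R ((U - A) \<union> C)"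
      using h unfolding lower_def by auto
    ultimately show ?case using ab by simp
  next
    case (19 a b c)
    obtain A B C D E F where abc: "a = (A, B)" "b = (C, D)" "c = (E, F)" by (metis surj_pair)
    have h: "A \<subseteq> B" "B \<subseteq> U" "E \<subseteq> F" "F \<subseteq> U" "R `` E \<subseteq> E" "C \<subseteq> D" using 19 abc by auto
    have "A \<inter> E \<subseteq> (U - B) \<union> C \<longleftrightarrow> E \<subseteq> lower U R ((U - A) \<union> C)"
      using h refl unfolding lower_def by blast
    moreover have "B \<inter> F \<subseteq> (U - A) \<union> D \<longleftrightarrow> F \<subseteq> (U - A) \<union> D" using h by blast
    ultimately show ?case by (simp add: abc)
  next
    case (20 a b c)
    obtain A B C D E F where abc: "a = (A, B)" "b = (C, D)" "c = (E, F)" by (metis surj_pair)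
    have h: "A \<subseteq> U" "C \<subseteq> U" "R `` A \<subseteq> A" "E \<subseteq> U" using 20 abc by auto
    have "lower U R ((U - A \<inter> C) \<union> E) = lower U R ((U - A) \<union> lower U R ((U - C) \<union> E))"
    proof (intro equalityI subsetI)
      fix x assume "x \<in> lower U R ((U - A \<inter> C) \<union> E)"
      then show "x \<in> lower U R ((U - A) \<union> lower U R ((U - C) \<union> E))"
        using h trans RU unfolding lower_def by blast
    next
      fix x assume "x \<in> lower U R ((U - A) \<union> lower U R ((U - C) \<union> E))"
      then show "x \<in> lower U R ((U - A \<inter> C) \<union> E)"
        using refl RU unfolding lower_def by blast
    qed
    then show ?case by (auto simp: abc)
  qed
qed

end

(*
  An element (A, B) of the rough set algebra records the points A verifying a formula and the
  points U - B falsifying it, so IRS U R is the algebra of a Kripke model of Nelson logic, and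
  soundness is persistence of verification and falsification along R.
  For completeness, take a non-theorem \<alpha> and intersect the prime theories with the finite set of
  subformulas of \<alpha> and their strong negations; ordered by inclusion these form a finite Kripke
  model refuting \<alpha>. A pair in IRS U R must decide every point whose only R-successor is itself,
  which this model need not do. Doubling every world into two R-equivalent copies leaves no such
  point, and this is where a quasiorder rather than a partial order is needed.
*)
theory Submission
  imports Defs
begin

section \<open>Soundness: persistence of verification and falsification along a quasiorder\<close>

section \<open>Soundness\<close>

lemma eval_closed:
  assumes "nelson_algebra A" and v: "\<And>p. v p \<in> carrier A"
  shows "eval A v \<alpha> \<in> carrier A"
proof -
  interpret nelson_algebra A by fact
  show ?thesis
    by (induction \<alpha>)
      (simp_all add: v join_closed meet_closed imp_closed sneg_closed zero_closed wneg_def)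
qed

text \<open>The coordinates behave differently: the first component of an implication or weak
  negation looks at all successors through \<open>lower\<close>, as in intuitionistic Kripke
  semantics, while every second component is computed point by point.\<close>

lemma eval_IRS_simps:
  "fst (eval (IRS U R) v (\<alpha> \<^bold>\<or> \<beta>)) = fst (eval (IRS U R) v \<alpha>) \<union> fst (eval (IRS U R) v \<beta>)"
  "snd (eval (IRS U R) v (\<alpha> \<^bold>\<or> \<beta>)) = snd (eval (IRS U R) v \<alpha>) \<union> snd (eval (IRS U R) v \<beta>)"
  "fst (eval (IRS U R) v (\<alpha> \<^bold>\<and> \<beta>)) = fst (eval (IRS U R) v \<alpha>) \<inter> fst (eval (IRS U R) v \<beta>)"
  "snd (eval (IRS U R) v (\<alpha> \<^bold>\<and> \<beta>)) = snd (eval (IRS U R) v \<alpha>) \<inter> snd (eval (IRS U R) v \<beta>)"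
  "fst (eval (IRS U R) v (\<alpha> \<^bold>\<rightarrow> \<beta>)) =
    lower U R ((U - fst (eval (IRS U R) v \<alpha>)) \<union> fst (eval (IRS U R) v \<beta>))"
  "snd (eval (IRS U R) v (\<alpha> \<^bold>\<rightarrow> \<beta>)) = (U - fst (eval (IRS U R) v \<alpha>)) \<union> snd (eval (IRS U R) v \<beta>)"
  "fst (eval (IRS U R) v (\<^bold>\<not> \<alpha>)) = lower U R (U - fst (eval (IRS U R) v \<alpha>))"
  "snd (eval (IRS U R) v (\<^bold>\<not> \<alpha>)) = U - fst (eval (IRS U R) v \<alpha>)"
  "fst (eval (IRS U R) v (\<^bold>\<sim> \<alpha>)) = U - snd (eval (IRS U R) v \<alpha>)"
  "snd (eval (IRS U R) v (\<^bold>\<sim> \<alpha>)) = U - fst (eval (IRS U R) v \<alpha>)"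
  by (simp_all add: IRS_def wneg_def split: prod.splits)

text \<open>Induction on derivations. By reflexivity an implication is verified at all points
  exactly when \<open>P\<close> of its premise is included in \<open>P\<close> of its conclusion, so
  each axiom becomes an inclusion or an equality of first components.\<close>

lemma CLSN_theorem_verified:
  assumes R: "preorder_on U R" and v: "\<And>p. v p \<in> carrier (IRS U R)" and "CLSN_theorem \<alpha>"
  shows "fst (eval (IRS U R) v \<alpha>) = U"
proof -
  have reflR: "\<And>x. x \<in> U \<Longrightarrow> (x, x) \<in> R" and RU: "R \<subseteq> U \<times> U"
    and trans: "\<And>x y z. (x, y) \<in> R \<Longrightarrow> (y, z) \<in> R \<Longrightarrow> (x, z) \<in> R"
    using R by (auto simp: preorder_on_def refl_on_def dest: transD)
  define P where "P \<beta> = fst (eval (IRS U R) v \<beta>)" for \<beta>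
  define Q where "Q \<beta> = snd (eval (IRS U R) v \<beta>)" for \<beta>
  \<comment> \<open>The description of the carrier supplies both consistency (\<open>PQ\<close>) and
    persistence (\<open>up\<close>) for every formula at once.\<close>
  have "(P \<beta>, Q \<beta>) \<in> carrier (IRS U R)" for \<beta>
    using eval_closed[of "IRS U R" v \<beta>, OF nelson_algebra_IRS[OF R] v] by (simp add: P_def Q_def)
  then have PQ: "P \<beta> \<subseteq> Q \<beta>" and QU: "Q \<beta> \<subseteq> U" and up: "R `` P \<beta> \<subseteq> P \<beta>" for \<beta>
    by (auto simp: carrier_IRS_iff[OF R])
  have PU: "P \<beta> \<subseteq> U" for \<beta>
    using PQ QU by blast
  have pers: "y \<in> P \<beta>" if "(x, y) \<in> R" "x \<in> P \<beta>" for x y \<beta>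
    using up that by blast
  have P_Impl: "P (\<beta> \<^bold>\<rightarrow> \<gamma>) = {x \<in> U. \<forall>y. (x, y) \<in> R \<longrightarrow> y \<in> P \<beta> \<longrightarrow> y \<in> P \<gamma>}" for \<beta> \<gamma>
    unfolding P_def eval_IRS_simps using RU by (auto simp: lower_def)
  have P_WNeg: "P (\<^bold>\<not> \<beta>) = {x \<in> U. \<forall>y. (x, y) \<in> R \<longrightarrow> y \<notin> P \<beta>}" for \<beta>
    unfolding P_def eval_IRS_simps using RU by (auto simp: lower_def)
  have P_Conj: "P (\<beta> \<^bold>\<and> \<gamma>) = P \<beta> \<inter> P \<gamma>" for \<beta> \<gamma>
    unfolding P_def eval_IRS_simps ..
  have P_Disj: "P (\<beta> \<^bold>\<or> \<gamma>) = P \<beta> \<union> P \<gamma>" for \<beta> \<gamma>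
    unfolding P_def eval_IRS_simps ..
  have P_SNeg: "P (\<^bold>\<sim> \<beta>) = U - Q \<beta>" for \<beta>
    unfolding P_def Q_def eval_IRS_simps ..
  have Q_simps: "Q (\<beta> \<^bold>\<rightarrow> \<gamma>) = (U - P \<beta>) \<union> Q \<gamma>" "Q (\<beta> \<^bold>\<and> \<gamma>) = Q \<beta> \<inter> Q \<gamma>"
    "Q (\<beta> \<^bold>\<or> \<gamma>) = Q \<beta> \<union> Q \<gamma>" "Q (\<^bold>\<not> \<beta>) = U - P \<beta>" "Q (\<^bold>\<sim> \<beta>) = U - P \<beta>" for \<beta> \<gamma>
    unfolding P_def Q_def eval_IRS_simps by (rule refl)+
  have Impl_U: "P (\<beta> \<^bold>\<rightarrow> \<gamma>) = U \<longleftrightarrow> P \<beta> \<subseteq> P \<gamma>" for \<beta> \<gamma>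
    using reflR PU[of \<beta>] PU[of \<gamma>] RU unfolding P_Impl by blast
  have Iff_U: "P (\<beta> \<^bold>\<leftrightarrow> \<gamma>) = U \<longleftrightarrow> P \<beta> = P \<gamma>" for \<beta> \<gamma>
    using Impl_U[of \<beta> \<gamma>] Impl_U[of \<gamma> \<beta>] PU[of "\<beta> \<^bold>\<rightarrow> \<gamma>"] PU[of "\<gamma> \<^bold>\<rightarrow> \<beta>"] unfolding P_Conj by blast
  have "P \<alpha> = U"
    using \<open>CLSN_theorem \<alpha>\<close>
  proof induction
    case (MP \<alpha> \<beta>)
    then show ?case using Impl_U PU by blast
  next
    case (Impl_K \<alpha> \<beta>)
    then show ?case unfolding Impl_U using pers subsetD[OF PU] by (auto simp: P_Impl)
  next
    case (Impl_S \<alpha> \<beta> \<gamma>)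
    then show ?case unfolding Impl_U unfolding P_Impl using trans reflR RU by blast
  next
    case (Conj_I \<alpha> \<beta>)
    then show ?case unfolding Impl_U using pers subsetD[OF PU] by (auto simp: P_Impl P_Conj)
  next
    case (Disj_E \<alpha> \<gamma> \<beta>)
    then show ?case unfolding Impl_U unfolding P_Impl P_Disj using trans RU by blast
  next
    case (WNeg_contrapos \<alpha> \<beta>)
    \<comment> \<open>A point above both premises that verified \<alpha> would verify
      \<open>WNeg \<beta>\<close> by transitivity, and \<beta> by persistence; reflexivity there
      gives the contradiction.\<close>
    then show ?case unfolding Impl_U unfolding P_Impl P_WNeg using pers trans reflR RU by blast
  next
    case (WNeg_explosion \<alpha> \<beta>)
    then show ?case unfolding Impl_U unfolding P_Impl P_WNeg using reflR RU by blast
  next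
    case (SNeg_explosion \<alpha> \<beta>)
    \<comment> \<open>Falsifying \<alpha> means verifying \<open>SNeg \<alpha>\<close>, so
      persistence carries it to \<open>y\<close>, where \<open>PQ\<close> excludes \<alpha>.\<close>
    have "y \<notin> P \<alpha>" if "x \<in> P (\<^bold>\<sim> \<alpha>)" "(x, y) \<in> R" for x y
      using pers[OF that(2,1)] PQ[of \<alpha>] by (auto simp: P_SNeg)
    then show ?case unfolding Impl_U using subsetD[OF PU] by (auto simp: P_Impl)
  next
    case (SNeg_Impl \<alpha> \<beta>)
    then show ?case unfolding Iff_U using PU by (auto simp: P_SNeg P_Conj Q_simps)
  next
    case (SNeg_WNeg \<alpha>)
    then show ?case unfolding Iff_U using PU by (auto simp: P_SNeg Q_simps)
  next
    case (SNeg_SNeg \<alpha>)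
    then show ?case unfolding Iff_U using PU by (auto simp: P_SNeg Q_simps)
  next
    case (SNeg_Conj \<alpha> \<beta>)
    then show ?case unfolding Iff_U by (auto simp: P_SNeg P_Disj Q_simps)
  next
    case (SNeg_Disj \<alpha> \<beta>)
    then show ?case unfolding Iff_U by (auto simp: P_SNeg P_Conj Q_simps)
  qed (auto simp: Impl_U P_Conj P_Disj)
  then show ?thesis by (simp add: P_def)
qed

text \<open>A carrier element \<open>(A, B)\<close> has \<open>A\<close> inside \<open>B\<close>
  inside \<open>U\<close>, so a full first component forces a full second one.\<close>

lemma CLSN_theorem_valid_in_IRS:
  fixes \<alpha> :: "'v form"
  assumes R: "preorder_on U R" and "CLSN_theorem \<alpha>"
  shows "valid_in (IRS U R) \<alpha>"
  unfolding valid_in_def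
proof (intro allI impI)
  fix v :: "'v \<Rightarrow> _" assume v: "\<forall>p. v p \<in> carrier (IRS U R)"
  obtain A B where AB: "eval (IRS U R) v \<alpha> = (A, B)" by fastforce
  have "(A, B) \<in> carrier (IRS U R)"
    using eval_closed[of "IRS U R" v \<alpha>] nelson_algebra_IRS[OF R] v AB by auto
  moreover have "A = U"
    using CLSN_theorem_verified[of U R v \<alpha>] assms v AB by auto
  ultimately show "eval (IRS U R) v \<alpha> = \<one>\<^bsub>IRS U R\<^esub>"
    using AB by (auto simp: carrier_IRS_iff[OF R]) (auto simp: IRS_def)
qed

section \<open>Prime theories as worlds: Lindenbaum extension and membership clauses for the
  connectives\<close>

section \<open>Prime theories\<close>

definition CLSN_theory :: "'v form set \<Rightarrow> bool" where
  "CLSN_theory T \<longleftrightarrow> Collect CLSN_theorem \<subseteq> T \<and> (\<forall>\<alpha> \<beta>. \<alpha> \<in> T \<longrightarrow> \<alpha> \<^bold>\<rightarrow> \<beta> \<in> T \<longrightarrow> \<beta> \<in> T)"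

text \<open>Properness expresses consistency: by the explosion axioms a theory other than
  \<open>UNIV\<close> contains no formula together with its strong negation.\<close>

definition prime_theory :: "'v form set \<Rightarrow> bool" where
  "prime_theory T \<longleftrightarrow> CLSN_theory T \<and> T \<noteq> UNIV \<and> (\<forall>\<alpha> \<beta>. \<alpha> \<^bold>\<or> \<beta> \<in> T \<longrightarrow> \<alpha> \<in> T \<or> \<beta> \<in> T)"

lemma CLSN_theory_theorem: "CLSN_theory T \<Longrightarrow> CLSN_theorem \<alpha> \<Longrightarrow> \<alpha> \<in> T"
  unfolding CLSN_theory_def by blast

lemma CLSN_theory_MP: "CLSN_theory T \<Longrightarrow> \<alpha> \<^bold>\<rightarrow> \<beta> \<in> T \<Longrightarrow> \<alpha> \<in> T \<Longrightarrow> \<beta> \<in> T"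
  unfolding CLSN_theory_def by blast

lemma CLSN_theory_theorem_MP: "CLSN_theory T \<Longrightarrow> CLSN_theorem (\<alpha> \<^bold>\<rightarrow> \<beta>) \<Longrightarrow> \<alpha> \<in> T \<Longrightarrow> \<beta> \<in> T"
  by (rule CLSN_theory_MP[OF _ CLSN_theory_theorem])

lemma CLSN_theory_theorem_MP2:
  "CLSN_theory T \<Longrightarrow> CLSN_theorem (\<alpha> \<^bold>\<rightarrow> \<beta> \<^bold>\<rightarrow> \<gamma>) \<Longrightarrow> \<alpha> \<in> T \<Longrightarrow> \<beta> \<in> T \<Longrightarrow> \<gamma> \<in> T"
  by (rule CLSN_theory_MP[OF _ CLSN_theory_theorem_MP])

lemma CLSN_theorem_Impl_refl: "CLSN_theorem (\<alpha> \<^bold>\<rightarrow> \<alpha>)"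
  by (rule MP[OF Impl_K MP[OF Impl_K Impl_S]])

lemma CLSN_theory_Conj_iff:
  assumes T: "CLSN_theory T"
  shows "\<alpha> \<^bold>\<and> \<beta> \<in> T \<longleftrightarrow> \<alpha> \<in> T \<and> \<beta> \<in> T"
  using CLSN_theory_theorem_MP[OF T Conj_E1, of \<alpha> \<beta>] CLSN_theory_theorem_MP[OF T Conj_E2, of \<alpha> \<beta>]
    CLSN_theory_theorem_MP2[OF T Conj_I, of \<alpha> \<beta>] by blast

lemma CLSN_theory_Iff:
  assumes "CLSN_theory T" "CLSN_theorem (\<alpha> \<^bold>\<leftrightarrow> \<beta>)"
  shows "\<alpha> \<in> T \<longleftrightarrow> \<beta> \<in> T"
  using CLSN_theory_theorem[OF assms] CLSN_theory_MP[OF assms(1), of \<alpha> \<beta>]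
    CLSN_theory_MP[OF assms(1), of \<beta> \<alpha>]
  unfolding CLSN_theory_Conj_iff[OF assms(1)] by blast

text \<open>The set below is the theory generated by \<open>T\<close> and \<open>\<beta>\<close>, by the deduction theorem.\<close>

lemma CLSN_theory_extend:
  assumes T: "CLSN_theory T"
  shows "CLSN_theory {\<gamma>. \<beta> \<^bold>\<rightarrow> \<gamma> \<in> T}" "insert \<beta> T \<subseteq> {\<gamma>. \<beta> \<^bold>\<rightarrow> \<gamma> \<in> T}"
proof -
  have K: "\<gamma> \<in> T \<Longrightarrow> \<beta> \<^bold>\<rightarrow> \<gamma> \<in> T" for \<gamma>
    using CLSN_theory_theorem_MP[OF T Impl_K] .
  then show "CLSN_theory {\<gamma>. \<beta> \<^bold>\<rightarrow> \<gamma> \<in> T}"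
    using CLSN_theory_theorem[OF T] CLSN_theory_theorem_MP2[OF T Impl_S, of \<beta>]
    unfolding CLSN_theory_def by blast
  show "insert \<beta> T \<subseteq> {\<gamma>. \<beta> \<^bold>\<rightarrow> \<gamma> \<in> T}"
    using K CLSN_theory_theorem[OF T CLSN_theorem_Impl_refl] by auto
qed

text \<open>Zorn's lemma gives a maximal theory \<open>M\<close> omitting \<gamma>. For \<beta>
  outside \<open>M\<close>, the theory generated by \<open>M\<close> and \<beta> must contain
  \<gamma>, so \<open>Impl \<beta> \<gamma>\<close> is in \<open>M\<close>; with both disjuncts
  outside, \<open>Disj_E\<close> would put \<gamma> into \<open>M\<close>.\<close>

lemma prime_theory_extend:
  assumes T: "CLSN_theory T" and "\<gamma> \<notin> T"
  obtains M where "prime_theory M" "T \<subseteq> M" "\<gamma> \<notin> M"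
proof -
  define F where "F = {S. CLSN_theory S \<and> T \<subseteq> S \<and> \<gamma> \<notin> S}"
  have "\<exists>M\<in>F. \<forall>S\<in>F. M \<subseteq> S \<longrightarrow> S = M"
  proof (rule subset_Zorn_nonempty)
    show "F \<noteq> {}" using assms by (auto simp: F_def)
    fix \<C> assume ne: "\<C> \<noteq> {}" and ch: "subset.chain F \<C>"
    have th: "\<And>S. S \<in> \<C> \<Longrightarrow> CLSN_theory S \<and> T \<subseteq> S \<and> \<gamma> \<notin> S"
      and lin: "\<And>S S'. S \<in> \<C> \<Longrightarrow> S' \<in> \<C> \<Longrightarrow> S \<subseteq> S' \<or> S' \<subseteq> S"
      using ch by (auto simp: subset_chain_def F_def)
    have "\<beta> \<in> \<Union>\<C>" if \<alpha>: "\<alpha> \<in> \<Union>\<C>" "\<alpha> \<^bold>\<rightarrow> \<beta> \<in> \<Union>\<C>" for \<alpha> \<beta>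
    proof -
      \<comment> \<open>Both premises of modus ponens lie in one member, the larger of two in the
        chain.\<close>
      obtain S where "S \<in> \<C>" "\<alpha> \<in> S" "\<alpha> \<^bold>\<rightarrow> \<beta> \<in> S"
        using \<alpha> lin by (meson UnionE subsetD)
      then show ?thesis using th CLSN_theory_MP by blast
    qed
    moreover have "T \<subseteq> \<Union>\<C>" "\<gamma> \<notin> \<Union>\<C>"
      using ne th by blast+
    moreover have "Collect CLSN_theorem \<subseteq> \<Union>\<C>"
      using T \<open>T \<subseteq> \<Union>\<C>\<close> unfolding CLSN_theory_def by blast
    ultimately show "\<Union>\<C> \<in> F" unfolding F_def CLSN_theory_def by blast
  qed
  then obtain M where M: "CLSN_theory M" "T \<subseteq> M" "\<gamma> \<notin> M"
    and maxi: "\<And>S. CLSN_theory S \<Longrightarrow> \<gamma> \<notin> S \<Longrightarrow> M \<subseteq> S \<Longrightarrow> S = M"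
    unfolding F_def by (metis (mono_tags, lifting) mem_Collect_eq subset_trans)
  have "\<beta> \<^bold>\<rightarrow> \<gamma> \<in> M" if "\<beta> \<notin> M" for \<beta>
    using maxi[of "{\<delta>. \<beta> \<^bold>\<rightarrow> \<delta> \<in> M}"] CLSN_theory_extend[OF M(1), of \<beta>] that by blast
  then have "\<alpha> \<in> M \<or> \<beta> \<in> M" if "\<alpha> \<^bold>\<or> \<beta> \<in> M" for \<alpha> \<beta>
    using CLSN_theory_MP[OF M(1) CLSN_theory_theorem_MP2[OF M(1) Disj_E], of \<alpha> \<gamma> \<beta>] that M(3)
    by blast
  then have "prime_theory M" using M unfolding prime_theory_def by blast
  with M show ?thesis using that by blast
qed

context
  fixes T :: "'v form set"
  assumes T: "prime_theory T"
begin

lemma prime_theory_CLSN_theory: "CLSN_theory T"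
  using T by (simp add: prime_theory_def)

lemma prime_theory_Disj_iff: "\<alpha> \<^bold>\<or> \<beta> \<in> T \<longleftrightarrow> \<alpha> \<in> T \<or> \<beta> \<in> T"
  using T CLSN_theory_theorem_MP[OF prime_theory_CLSN_theory Disj_I1, of \<alpha> \<beta>]
    CLSN_theory_theorem_MP[OF prime_theory_CLSN_theory Disj_I2, of \<beta> \<alpha>]
  unfolding prime_theory_def by blast

text \<open>The Kripke clause for implication. If \<open>Impl \<alpha> \<beta>\<close> is missing
  from \<open>T\<close>, the theory generated by \<open>T\<close> and \<alpha> omits \<beta>, and a
  prime extension of it still omitting \<beta> is the refuting world.\<close>

lemma prime_theory_Impl_iff:
  "\<alpha> \<^bold>\<rightarrow> \<beta> \<in> T \<longleftrightarrow> (\<forall>S. prime_theory S \<longrightarrow> T \<subseteq> S \<longrightarrow> \<alpha> \<in> S \<longrightarrow> \<beta> \<in> S)"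
proof
  assume "\<alpha> \<^bold>\<rightarrow> \<beta> \<in> T"
  then show "\<forall>S. prime_theory S \<longrightarrow> T \<subseteq> S \<longrightarrow> \<alpha> \<in> S \<longrightarrow> \<beta> \<in> S"
    using CLSN_theory_MP unfolding prime_theory_def by blast
next
  assume *: "\<forall>S. prime_theory S \<longrightarrow> T \<subseteq> S \<longrightarrow> \<alpha> \<in> S \<longrightarrow> \<beta> \<in> S"
  show "\<alpha> \<^bold>\<rightarrow> \<beta> \<in> T"
  proof (rule ccontr)
    assume "\<alpha> \<^bold>\<rightarrow> \<beta> \<notin> T"
    then obtain M where "prime_theory M" "{\<gamma>. \<alpha> \<^bold>\<rightarrow> \<gamma> \<in> T} \<subseteq> M" "\<beta> \<notin> M"
      using prime_theory_extend[OF CLSN_theory_extend(1)[OF prime_theory_CLSN_theory]]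
      by (metis mem_Collect_eq)
    with * CLSN_theory_extend(2)[OF prime_theory_CLSN_theory, of \<alpha>] show False by blast
  qed
qed

text \<open>The language has no constant for falsity; the weak negation of a theorem serves as one,
  so weak negation inherits the clause for implication.\<close>

lemma WNeg_iff_Impl_absurd: "\<^bold>\<not> \<alpha> \<in> T \<longleftrightarrow> \<alpha> \<^bold>\<rightarrow> \<^bold>\<not> (\<beta> \<^bold>\<rightarrow> \<beta>) \<in> T"
proof
  assume "\<^bold>\<not> \<alpha> \<in> T"
  then have "(\<beta> \<^bold>\<rightarrow> \<beta>) \<^bold>\<rightarrow> \<^bold>\<not> \<alpha> \<in> T"
    by (rule CLSN_theory_theorem_MP[OF prime_theory_CLSN_theory Impl_K])
  then show "\<alpha> \<^bold>\<rightarrow> \<^bold>\<not> (\<beta> \<^bold>\<rightarrow> \<beta>) \<in> T"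
    by (rule CLSN_theory_theorem_MP[OF prime_theory_CLSN_theory WNeg_contrapos])
next
  assume "\<alpha> \<^bold>\<rightarrow> \<^bold>\<not> (\<beta> \<^bold>\<rightarrow> \<beta>) \<in> T"
  then have "(\<beta> \<^bold>\<rightarrow> \<beta>) \<^bold>\<rightarrow> \<^bold>\<not> \<alpha> \<in> T"
    by (rule CLSN_theory_theorem_MP[OF prime_theory_CLSN_theory WNeg_contrapos])
  then show "\<^bold>\<not> \<alpha> \<in> T"
    using CLSN_theory_theorem[OF prime_theory_CLSN_theory CLSN_theorem_Impl_refl]
    by (rule CLSN_theory_MP[OF prime_theory_CLSN_theory])
qed

lemma prime_theory_no_absurd: "\<^bold>\<not> (\<beta> \<^bold>\<rightarrow> \<beta>) \<notin> T"
  using T CLSN_theory_theorem_MP[OF prime_theory_CLSN_theory WNeg_explosion]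
  unfolding prime_theory_def by blast

lemma prime_theory_consistent: "\<alpha> \<in> T \<Longrightarrow> \<^bold>\<sim> \<alpha> \<notin> T"
  using T CLSN_theory_theorem_MP2[OF prime_theory_CLSN_theory SNeg_explosion]
  unfolding prime_theory_def by blast

text \<open>Falsification is local: the axioms reduce it to membership in the same theory
  \<open>T\<close>. Only falsity of variables remains as independent data.\<close>

lemma prime_theory_SNeg_iff:
  "\<^bold>\<sim> (\<alpha> \<^bold>\<rightarrow> \<beta>) \<in> T \<longleftrightarrow> \<alpha> \<in> T \<and> \<^bold>\<sim> \<beta> \<in> T"
  "\<^bold>\<sim> (\<alpha> \<^bold>\<and> \<beta>) \<in> T \<longleftrightarrow> \<^bold>\<sim> \<alpha> \<in> T \<or> \<^bold>\<sim> \<beta> \<in> T"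
  "\<^bold>\<sim> (\<alpha> \<^bold>\<or> \<beta>) \<in> T \<longleftrightarrow> \<^bold>\<sim> \<alpha> \<in> T \<and> \<^bold>\<sim> \<beta> \<in> T"
  "\<^bold>\<sim> (\<^bold>\<not> \<alpha>) \<in> T \<longleftrightarrow> \<alpha> \<in> T"
  "\<^bold>\<sim> (\<^bold>\<sim> \<alpha>) \<in> T \<longleftrightarrow> \<alpha> \<in> T"
  by (simp_all add: prime_theory_Disj_iff CLSN_theory_Conj_iff[OF prime_theory_CLSN_theory]
      CLSN_theory_Iff[OF prime_theory_CLSN_theory SNeg_Impl]
      CLSN_theory_Iff[OF prime_theory_CLSN_theory SNeg_Conj]
      CLSN_theory_Iff[OF prime_theory_CLSN_theory SNeg_Disj]
      CLSN_theory_Iff[OF prime_theory_CLSN_theory SNeg_WNeg]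
      CLSN_theory_Iff[OF prime_theory_CLSN_theory SNeg_SNeg])

end

lemma prime_theory_WNeg_iff:
  assumes "prime_theory T"
  shows "\<^bold>\<not> \<alpha> \<in> T \<longleftrightarrow> (\<forall>S. prime_theory S \<longrightarrow> T \<subseteq> S \<longrightarrow> \<alpha> \<notin> S)"
  using prime_theory_no_absurd
  unfolding WNeg_iff_Impl_absurd[OF assms, where \<beta> = \<alpha>] prime_theory_Impl_iff[OF assms] by blast

section \<open>Filtration of the prime theories to a finite quasiorder, and the truth lemma\<close>

section \<open>The finite countermodel\<close>

primrec subforms :: "'v form \<Rightarrow> 'v form set" where
  "subforms (Var p) = {Var p}"
| "subforms (\<alpha> \<^bold>\<or> \<beta>) = insert (\<alpha> \<^bold>\<or> \<beta>) (subforms \<alpha> \<union> subforms \<beta>)"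
| "subforms (\<alpha> \<^bold>\<and> \<beta>) = insert (\<alpha> \<^bold>\<and> \<beta>) (subforms \<alpha> \<union> subforms \<beta>)"
| "subforms (\<alpha> \<^bold>\<rightarrow> \<beta>) = insert (\<alpha> \<^bold>\<rightarrow> \<beta>) (subforms \<alpha> \<union> subforms \<beta>)"
| "subforms (\<^bold>\<not> \<alpha>) = insert (\<^bold>\<not> \<alpha>) (subforms \<alpha>)"
| "subforms (\<^bold>\<sim> \<alpha>) = insert (\<^bold>\<sim> \<alpha>) (subforms \<alpha>)"

lemma finite_subforms: "finite (subforms \<alpha>)"
  by (induction \<alpha>) auto

lemma subforms_refl: "\<alpha> \<in> subforms \<alpha>"
  by (cases \<alpha>) auto

text \<open>Realizes two copies of each element of \<open>W\<close> inside the prescribed type, by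
  coding \<open>W\<close> times the booleans into the naturals and these into the infinite type. The
  map \<open>w\<close> forgets the copy; flipping the boolean gives the twin.\<close>

lemma ex_doubled_cover:
  assumes "infinite (UNIV :: 'u set)" "finite W"
  obtains U :: "'u set" and w where "finite U" "w ` U = W"
    "\<And>x. x \<in> U \<Longrightarrow> \<exists>y\<in>U. y \<noteq> x \<and> w y = w x"
proof -
  obtain g :: "nat \<Rightarrow> 'u" where g: "inj g"
    using assms(1) infinite_countable_subset by blast
  let ?D = "W \<times> (UNIV :: bool set)"
  obtain e :: "_ \<Rightarrow> nat" where e: "inj_on e ?D"
    using finite_imp_inj_to_nat_seg[of ?D] assms(2) by auto
  define f where "f = g \<circ> e"
  have f: "inj_on f ?D"
    unfolding f_def using e g by (meson comp_inj_on inj_on_subset subset_UNIV)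
  define w where "w x = fst (inv_into ?D f x)" for x
  have w: "w (f (c, b)) = c" if "c \<in> W" for c b
    using that f by (simp add: w_def)
  show ?thesis
  proof (rule that[of "f ` ?D" w])
    show "finite (f ` ?D)" using assms(2) by simp
    show "w ` f ` ?D = W" using w by (force simp: image_iff)
    fix x assume "x \<in> f ` ?D"
    then obtain c b where cb: "c \<in> W" "x = f (c, b)" by auto
    moreover have "f (c, \<not> b) \<noteq> f (c, b)"
      using f cb(1) by (auto dest: inj_onD)
    ultimately show "\<exists>y\<in>f ` ?D. y \<noteq> x \<and> w y = w x"
      by (intro bexI[of _ "f (c, \<not> b)"]) (auto simp: w)
  qed
qed

lemma ex_finite_IRS_countermodel:
  fixes \<alpha> :: "'v form"
  assumes inf: "infinite (UNIV :: 'u set)" and \<alpha>: "\<not> CLSN_theorem \<alpha>"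
  obtains U :: "'u set" and R where "finite U" "preorder_on U R" "\<not> valid_in (IRS U R) \<alpha>"
proof -
  \<comment> \<open>Strong negations are included because a world records falsity of \<beta> as
    membership of \<open>SNeg \<beta>\<close>.\<close>
  define \<Phi> where "\<Phi> = subforms \<alpha> \<union> SNeg ` subforms \<alpha>"
  define W where "W = {T \<inter> \<Phi> | T. prime_theory T}"
  have "finite \<Phi>" by (simp add: \<Phi>_def finite_subforms)
  moreover have "W \<subseteq> Pow \<Phi>" by (auto simp: W_def)
  ultimately have "finite W" by (meson finite_Pow_iff finite_subset)
  then obtain U :: "'u set" and w where U: "finite U" and wU: "w ` U = W"
    and twin: "\<And>x. x \<in> U \<Longrightarrow> \<exists>y\<in>U. y \<noteq> x \<and> w y = w x"
    using ex_doubled_cover[OF inf] by metis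
  define R where "R = {(x, y) \<in> U \<times> U. w x \<subseteq> w y}"
  have R: "preorder_on U R"
    by (auto simp: R_def preorder_on_def refl_on_def trans_def)
  \<comment> \<open>The twin is a second successor, so the carrier condition on points with a single
    successor holds vacuously.\<close>
  have no_single: "R `` {x} \<noteq> {x}" if "x \<in> U" for x
    using twin[OF that] that by (auto simp: R_def)
  have world: "\<exists>T. prime_theory T \<and> w x = T \<inter> \<Phi>" if "x \<in> U" for x
    using that wU unfolding W_def by blast
  \<comment> \<open>An arbitrary prime theory with the given trace on \<Phi>; \<open>R\<close>
    compares only the traces \<open>w x\<close>, not these chosen theories.\<close>
  define th where "th x = (SOME T. prime_theory T \<and> w x = T \<inter> \<Phi>)" for x
  have th: "prime_theory (th x)" "w x = th x \<inter> \<Phi>" if "x \<in> U" for x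
    using someI_ex[OF world[OF that]] by (simp_all add: th_def)
  have point: "\<exists>x\<in>U. w x = T \<inter> \<Phi>" if "prime_theory T" for T
  proof -
    have "T \<inter> \<Phi> \<in> w ` U" using that unfolding wU W_def by blast
    then show ?thesis by (metis imageE)
  qed
  define v where "v p = ({x \<in> U. Var p \<in> w x}, {x \<in> U. \<^bold>\<sim> Var p \<notin> w x})" for p
  have v: "v p \<in> carrier (IRS U R)" for p
  proof -
    have "\<^bold>\<sim> Var p \<notin> w x" if "x \<in> U" "Var p \<in> w x" for x
      using th[OF that(1)] prime_theory_consistent[of "th x" "Var p"] that(2) by simp
    then show ?thesis
      unfolding v_def carrier_IRS_iff[OF R] using no_single by (auto simp: R_def)
  qed
  \<comment> \<open>Forwards, the implication lies in \<Phi>, so trace inclusion carries it to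
    \<open>y\<close>, where \<open>th y\<close> is closed under modus ponens. Backwards, each prime
    theory above \<open>th x\<close> has its trace at some point related to
    \<open>x\<close>.\<close>
  have Impl_w: "\<beta> \<^bold>\<rightarrow> \<gamma> \<in> w x \<longleftrightarrow> (\<forall>y. (x, y) \<in> R \<longrightarrow> \<beta> \<in> w y \<longrightarrow> \<gamma> \<in> w y)"
    if x: "x \<in> U" and \<Phi>: "\<beta> \<^bold>\<rightarrow> \<gamma> \<in> \<Phi>" "\<beta> \<in> \<Phi>" "\<gamma> \<in> \<Phi>" for x \<beta> \<gamma>
  proof
    assume *: "\<beta> \<^bold>\<rightarrow> \<gamma> \<in> w x"
    show "\<forall>y. (x, y) \<in> R \<longrightarrow> \<beta> \<in> w y \<longrightarrow> \<gamma> \<in> w y"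
    proof (intro allI impI)
      fix y assume y: "(x, y) \<in> R" "\<beta> \<in> w y"
      then have "y \<in> U" "\<beta> \<^bold>\<rightarrow> \<gamma> \<in> w y" using * by (auto simp: R_def)
      then show "\<gamma> \<in> w y"
        using y th[of y] \<Phi> CLSN_theory_MP[OF prime_theory_CLSN_theory, of "th y" \<beta> \<gamma>] by auto
    qed
  next
    assume *: "\<forall>y. (x, y) \<in> R \<longrightarrow> \<beta> \<in> w y \<longrightarrow> \<gamma> \<in> w y"
    have "\<gamma> \<in> S" if S: "prime_theory S" "th x \<subseteq> S" "\<beta> \<in> S" for S
    proof -
      obtain y where y: "y \<in> U" "w y = S \<inter> \<Phi>" using point[OF S(1)] by blast
      then have "(x, y) \<in> R" using S(2) x th(2)[OF x] by (auto simp: R_def)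
      then show ?thesis using * S \<Phi> y by blast
    qed
    then show "\<beta> \<^bold>\<rightarrow> \<gamma> \<in> w x"
      using prime_theory_Impl_iff[OF th(1)[OF x]] \<Phi> th(2)[OF x] by auto
  qed
  have WNeg_w: "\<^bold>\<not> \<beta> \<in> w x \<longleftrightarrow> (\<forall>y. (x, y) \<in> R \<longrightarrow> \<beta> \<notin> w y)"
    if x: "x \<in> U" and \<Phi>: "\<^bold>\<not> \<beta> \<in> \<Phi>" "\<beta> \<in> \<Phi>" for x \<beta>
  proof
    assume *: "\<^bold>\<not> \<beta> \<in> w x"
    show "\<forall>y. (x, y) \<in> R \<longrightarrow> \<beta> \<notin> w y"
    proof (intro allI impI)
      fix y assume y: "(x, y) \<in> R"
      then have "y \<in> U" "\<^bold>\<not> \<beta> \<in> w y" using * by (auto simp: R_def)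
      then show "\<beta> \<notin> w y"
        using th[of y] prime_theory_WNeg_iff[of "th y" \<beta>] by auto
    qed
  next
    assume *: "\<forall>y. (x, y) \<in> R \<longrightarrow> \<beta> \<notin> w y"
    have "\<beta> \<notin> S" if S: "prime_theory S" "th x \<subseteq> S" for S
    proof -
      obtain y where y: "y \<in> U" "w y = S \<inter> \<Phi>" using point[OF S(1)] by blast
      then have "(x, y) \<in> R" using S(2) x th(2)[OF x] by (auto simp: R_def)
      then show ?thesis using * S \<Phi> y by blast
    qed
    then show "\<^bold>\<not> \<beta> \<in> w x"
      using prime_theory_WNeg_iff[OF th(1)[OF x]] \<Phi> th(2)[OF x] by auto
  qed
  \<comment> \<open>Carrying \<beta> and \<open>SNeg \<beta>\<close> together lets the induction
    pass through strong negation; the restriction to subformulas of \<alpha> keeps both in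
    \<Phi>.\<close>
  have truth: "eval (IRS U R) v \<beta> = ({x \<in> U. \<beta> \<in> w x}, {x \<in> U. \<^bold>\<sim> \<beta> \<notin> w x})"
    if "subforms \<beta> \<subseteq> subforms \<alpha>" for \<beta>
    using that
  proof (induction \<beta>)
    case (Var p)
    then show ?case by (simp add: v_def)
  next
    case (Disj \<beta> \<gamma>)
    then have \<Phi>: "\<beta> \<^bold>\<or> \<gamma> \<in> \<Phi>" "\<^bold>\<sim> (\<beta> \<^bold>\<or> \<gamma>) \<in> \<Phi>" "\<beta> \<in> \<Phi>" "\<gamma> \<in> \<Phi>" "\<^bold>\<sim> \<beta> \<in> \<Phi>" "\<^bold>\<sim> \<gamma> \<in> \<Phi>"
      using subforms_refl[of \<beta>] subforms_refl[of \<gamma>] by (auto simp: \<Phi>_def)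
    show ?case
      by (rule prod_eqI; use Disj \<Phi> th in
        \<open>auto simp: eval_IRS_simps prime_theory_Disj_iff prime_theory_SNeg_iff simp del: eval.simps\<close>)
  next
    case (Conj \<beta> \<gamma>)
    then have \<Phi>: "\<beta> \<^bold>\<and> \<gamma> \<in> \<Phi>" "\<^bold>\<sim> (\<beta> \<^bold>\<and> \<gamma>) \<in> \<Phi>" "\<beta> \<in> \<Phi>" "\<gamma> \<in> \<Phi>" "\<^bold>\<sim> \<beta> \<in> \<Phi>" "\<^bold>\<sim> \<gamma> \<in> \<Phi>"
      using subforms_refl[of \<beta>] subforms_refl[of \<gamma>] by (auto simp: \<Phi>_def)
    show ?case
      by (rule prod_eqI; use Conj \<Phi> th in
        \<open>auto simp: eval_IRS_simps CLSN_theory_Conj_iff prime_theory_CLSN_theory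
          prime_theory_SNeg_iff simp del: eval.simps\<close>)
  next
    case (Impl \<beta> \<gamma>)
    then have \<Phi>: "\<beta> \<^bold>\<rightarrow> \<gamma> \<in> \<Phi>" "\<^bold>\<sim> (\<beta> \<^bold>\<rightarrow> \<gamma>) \<in> \<Phi>" "\<beta> \<in> \<Phi>" "\<gamma> \<in> \<Phi>" "\<^bold>\<sim> \<beta> \<in> \<Phi>" "\<^bold>\<sim> \<gamma> \<in> \<Phi>"
      using subforms_refl[of \<beta>] subforms_refl[of \<gamma>] by (auto simp: \<Phi>_def)
    have IH: "eval (IRS U R) v \<beta> = ({x \<in> U. \<beta> \<in> w x}, {x \<in> U. \<^bold>\<sim> \<beta> \<notin> w x})"
      "eval (IRS U R) v \<gamma> = ({x \<in> U. \<gamma> \<in> w x}, {x \<in> U. \<^bold>\<sim> \<gamma> \<notin> w x})"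
      using Impl by simp_all
    show ?case
    proof (rule prod_eqI)
      show "fst (eval (IRS U R) v (\<beta> \<^bold>\<rightarrow> \<gamma>)) =
          fst ({x \<in> U. \<beta> \<^bold>\<rightarrow> \<gamma> \<in> w x}, {x \<in> U. \<^bold>\<sim> (\<beta> \<^bold>\<rightarrow> \<gamma>) \<notin> w x})"
        unfolding eval_IRS_simps IH using Impl_w[OF _ \<Phi>(1,3,4)]
        by (auto simp: lower_def R_def)
      show "snd (eval (IRS U R) v (\<beta> \<^bold>\<rightarrow> \<gamma>)) =
          snd ({x \<in> U. \<beta> \<^bold>\<rightarrow> \<gamma> \<in> w x}, {x \<in> U. \<^bold>\<sim> (\<beta> \<^bold>\<rightarrow> \<gamma>) \<notin> w x})"
        unfolding eval_IRS_simps IH using \<Phi> th by (auto simp: prime_theory_SNeg_iff)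
    qed
  next
    case (WNeg \<beta>)
    then have \<Phi>: "\<^bold>\<not> \<beta> \<in> \<Phi>" "\<^bold>\<sim> (\<^bold>\<not> \<beta>) \<in> \<Phi>" "\<beta> \<in> \<Phi>" "\<^bold>\<sim> \<beta> \<in> \<Phi>"
      using subforms_refl[of \<beta>] by (auto simp: \<Phi>_def)
    have IH: "eval (IRS U R) v \<beta> = ({x \<in> U. \<beta> \<in> w x}, {x \<in> U. \<^bold>\<sim> \<beta> \<notin> w x})"
      using WNeg by simp
    show ?case
    proof (rule prod_eqI)
      show "fst (eval (IRS U R) v (\<^bold>\<not> \<beta>)) =
          fst ({x \<in> U. \<^bold>\<not> \<beta> \<in> w x}, {x \<in> U. \<^bold>\<sim> (\<^bold>\<not> \<beta>) \<notin> w x})"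
        unfolding eval_IRS_simps IH using WNeg_w[OF _ \<Phi>(1,3)]
        by (auto simp: lower_def R_def)
      show "snd (eval (IRS U R) v (\<^bold>\<not> \<beta>)) =
          snd ({x \<in> U. \<^bold>\<not> \<beta> \<in> w x}, {x \<in> U. \<^bold>\<sim> (\<^bold>\<not> \<beta>) \<notin> w x})"
        unfolding eval_IRS_simps IH using \<Phi> th by (auto simp: prime_theory_SNeg_iff)
    qed
  next
    case (SNeg \<beta>)
    then have \<Phi>: "\<^bold>\<sim> (\<^bold>\<sim> \<beta>) \<in> \<Phi>" "\<beta> \<in> \<Phi>" "\<^bold>\<sim> \<beta> \<in> \<Phi>"
      using subforms_refl[of \<beta>] by (auto simp: \<Phi>_def)
    show ?case
      by (rule prod_eqI; use SNeg \<Phi> th in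
        \<open>auto simp: eval_IRS_simps prime_theory_SNeg_iff simp del: eval.simps\<close>)
  qed
  \<comment> \<open>The theorems form a theory omitting \<alpha>; the trace of a prime extension
    omitting \<alpha> is the refuting point.\<close>
  have "CLSN_theory (Collect CLSN_theorem)"
    unfolding CLSN_theory_def using MP by blast
  then obtain T where T: "prime_theory T" "\<alpha> \<notin> T"
    using prime_theory_extend[of "Collect CLSN_theorem" \<alpha>] \<alpha> by auto
  then obtain x where "x \<in> U" "\<alpha> \<notin> w x" using point[OF T(1)] by auto
  then have "eval (IRS U R) v \<alpha> \<noteq> \<one>\<^bsub>IRS U R\<^esub>"
    unfolding truth[OF subset_refl] by (auto simp: IRS_def)
  then have "\<not> valid_in (IRS U R) \<alpha>" using v by (auto simp: valid_in_def)
  then show ?thesis using that U R by blast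
qed

text \<open>One infinite type of points suffices, since it has room for finite countermodels of
  every size. Finiteness is asked of the algebra, and follows when \<open>U\<close> is
  finite.\<close>

theorem theorem4p1:
  fixes \<alpha> :: "'v form"
  assumes "infinite (UNIV :: 'u set)"
  shows "CLSN_theorem \<alpha> \<longleftrightarrow>
    (\<forall>(U :: 'u set) R. preorder_on U R \<and> finite (carrier (IRS U R)) \<longrightarrow> valid_in (IRS U R) \<alpha>)"
proof
  assume "CLSN_theorem \<alpha>"
  then show "\<forall>(U :: 'u set) R. preorder_on U R \<and> finite (carrier (IRS U R)) \<longrightarrow> valid_in (IRS U R) \<alpha>"
    by (auto intro: CLSN_theorem_valid_in_IRS)
next
  assume valid: "\<forall>(U :: 'u set) R. preorder_on U R \<and> finite (carrier (IRS U R)) \<longrightarrow> valid_in (IRS U R) \<alpha>"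
  show "CLSN_theorem \<alpha>"
  proof (rule ccontr)
    assume "\<not> CLSN_theorem \<alpha>"
    then obtain U :: "'u set" and R
      where UR: "finite U" "preorder_on U R" "\<not> valid_in (IRS U R) \<alpha>"
      using ex_finite_IRS_countermodel[OF assms] by blast
    have "carrier (IRS U R) \<subseteq> Pow U \<times> Pow U"
      by (auto simp: IRS_def lower_def upper_def)
    then have "finite (carrier (IRS U R))"
      using UR(1) by (meson finite_Pow_iff finite_SigmaI finite_subset)
    then show False using valid UR by blast
  qed
qed

end
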